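(* For every purely modal formula $A$ (no $\blacksquare$, no $\lozenge^{\bullet}$), $A$ is derivable in $\mathbf{DKS5}$ iff $A$ is a theorem of S5.
   Context: Formulae are in negation normal form over $a,\neg a,\lor,\land,\square,\blacksquare,\lozenge,\lozenge^{\bullet}$, where $\lozenge^{\bullet}$ is the past diamond (dual of $\blacksquare$). Nested sequents are multisets of formulae and structures $\circ\{\Gamma\}$, $\bullet\{\Delta\}$; $\Sigma[\,]$ is a context with a hole at any depth. $\mathbf{DKS5}$ is the restriction of the deep system $\mathbf{DS5}$ to its purely modal rules (those mentioning no $\blacksquare$, $\lozenge^{\bullet}$ or $\bullet$), namely: $id$: $\Sigma[a,\overline a]$; $\land$: from $\Sigma[A\land B,A]$ and $\Sigma[A\land B,B]$ infer $\Sigma[A\land B]$; $\lor$: from $\Sigma[A\lor B,A,B]$ infer $\Sigma[A\lor B]$; $\square$: from $\Sigma[\square A,\circ\{A\}]$ infer $\Sigma[\square A]$; $\lozenge_1$: from $\Sigma[\circ\{\Delta,A\},\lozenge A]$ infer $\Sigma[\circ\{\Delta\},\lozenge A]$; $T_b$: from $\Sigma[\lozenge A,A]$ infer $\Sigma[\lozenge A]$; $4_c$: from $\Sigma[\lozenge A,\circ\{\lozenge A,\Delta\}]$ infer $\Sigma[\lozenge A,\circ\{\Delta\}]$; $5_b$: from $\Sigma[\circ\{\Delta,\lozenge A\},\lozenge A]$ infer $\Sigma[\circ\{\Delta,\lozenge A\}]$. *)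

theory Defs
  imports Main "HOL-Library.Multiset"
begin

datatype 'a fm =
    Pos 'a | Neg 'a
  | Or "'a fm" "'a fm" | And "'a fm" "'a fm"
  | Box "'a fm" | BBox "'a fm"    \<comment> \<open>\<open>\<box>\<close> and its past counterpart \<open>\<blacksquare>\<close>\<close>
  | Dia "'a fm" | BDia "'a fm"    \<comment> \<open>\<open>\<diamond>\<close> and the past diamond\<close>

primrec dual :: "'a fm \<Rightarrow> 'a fm" where
  "dual (Pos a) = Neg a"
| "dual (Neg a) = Pos a"
| "dual (Or A B) = And (dual A) (dual B)"
| "dual (And A B) = Or (dual A) (dual B)"
| "dual (Box A) = Dia (dual A)"
| "dual (BBox A) = BDia (dual A)"
| "dual (Dia A) = Box (dual A)"
| "dual (BDia A) = BBox (dual A)"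

definition Imp :: "'a fm \<Rightarrow> 'a fm \<Rightarrow> 'a fm" where
  "Imp A B = Or (dual A) B"

primrec purely_modal :: "'a fm \<Rightarrow> bool" where
  "purely_modal (Pos a) \<longleftrightarrow> True"
| "purely_modal (Neg a) \<longleftrightarrow> True"
| "purely_modal (Or A B) \<longleftrightarrow> purely_modal A \<and> purely_modal B"
| "purely_modal (And A B) \<longleftrightarrow> purely_modal A \<and> purely_modal B"
| "purely_modal (Box A) \<longleftrightarrow> purely_modal A"
| "purely_modal (BBox A) \<longleftrightarrow> False"
| "purely_modal (Dia A) \<longleftrightarrow> purely_modal A"
| "purely_modal (BDia A) \<longleftrightarrow> False"

text \<open>
  A nested sequent is a multiset of formulae and of structures \<open>\<circ>{\<Gamma>}\<close> (\<open>White \<Gamma>\<close>) and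
  \<open>\<bullet>{\<Gamma>}\<close> (\<open>Black \<Gamma>\<close>).
\<close>

datatype 'a struct =
    Form "'a fm" | White "'a struct multiset" | Black "'a struct multiset"

type_synonym 'a seq = "'a struct multiset"

text \<open>
  A context has exactly one hole, at any depth; the multiset argument collects the siblings
  of the hole (for \<open>Hole\<close>) or of the structure containing it.
\<close>

datatype 'a ctxt =
    Hole "'a seq" | InWhite "'a seq" "'a ctxt" | InBlack "'a seq" "'a ctxt"

primrec fill :: "'a ctxt \<Rightarrow> 'a seq \<Rightarrow> 'a seq" where
  "fill (Hole \<Gamma>) \<Delta> = \<Gamma> + \<Delta>"
| "fill (InWhite \<Gamma> S) \<Delta> = \<Gamma> + {#White (fill S \<Delta>)#}"
| "fill (InBlack \<Gamma> S) \<Delta> = \<Gamma> + {#Black (fill S \<Delta>)#}"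

text \<open>
  The rules of \<open>DKS5\<close>. Sequents, contexts and formulae range over the full tense language;
  only the rules are restricted.
\<close>

inductive DKS5 :: "'a seq \<Rightarrow> bool" where
  id: "DKS5 (fill S {#Form (Pos a), Form (Neg a)#})"
| conj: "DKS5 (fill S {#Form (And A B), Form A#}) \<Longrightarrow>
    DKS5 (fill S {#Form (And A B), Form B#}) \<Longrightarrow>
    DKS5 (fill S {#Form (And A B)#})"
| disj: "DKS5 (fill S {#Form (Or A B), Form A, Form B#}) \<Longrightarrow>
    DKS5 (fill S {#Form (Or A B)#})"
| box: "DKS5 (fill S {#Form (Box A), White {#Form A#}#}) \<Longrightarrow>
    DKS5 (fill S {#Form (Box A)#})"
| dia1: "DKS5 (fill S {#White (\<Delta> + {#Form A#}), Form (Dia A)#}) \<Longrightarrow>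
    DKS5 (fill S {#White \<Delta>, Form (Dia A)#})"
| Tb: "DKS5 (fill S {#Form (Dia A), Form A#}) \<Longrightarrow>
    DKS5 (fill S {#Form (Dia A)#})"
| c4: "DKS5 (fill S {#Form (Dia A), White (\<Delta> + {#Form (Dia A)#})#}) \<Longrightarrow>
    DKS5 (fill S {#Form (Dia A), White \<Delta>#})"
| b5: "DKS5 (fill S {#White (\<Delta> + {#Form (Dia A)#}), Form (Dia A)#}) \<Longrightarrow>
    DKS5 (fill S {#White (\<Delta> + {#Form (Dia A)#})#})"

definition derivable_DKS5 :: "'a fm \<Rightarrow> bool" where
  "derivable_DKS5 A \<longleftrightarrow> DKS5 {#Form A#}"

text \<open>
  A formula is a substitution instance of a propositional tautology iff it is true under every
  valuation that respects \<open>\<or>\<close>, \<open>\<and>\<close> and negation, modal formulae being otherwise unconstrained.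
  Negation is the defined operation \<open>dual\<close>, so the values of \<open>\<box>A\<close> and of the diamond of its
  dual are linked.
\<close>

definition boolean_valuation :: "('a fm \<Rightarrow> bool) \<Rightarrow> bool" where
  "boolean_valuation v \<longleftrightarrow>
     (\<forall>A B. v (Or A B) \<longleftrightarrow> v A \<or> v B) \<and>
     (\<forall>A B. v (And A B) \<longleftrightarrow> v A \<and> v B) \<and>
     (\<forall>A. v (dual A) \<longleftrightarrow> \<not> v A)"

definition tautology :: "'a fm \<Rightarrow> bool" where
  "tautology A \<longleftrightarrow> (\<forall>v. boolean_valuation v \<longrightarrow> v A)"

text \<open>
  The Hilbert system for \<open>S5\<close>. All axioms are purely modal, hence so are all theorems.
\<close>

inductive S5 :: "'a fm \<Rightarrow> bool" where
  taut: "purely_modal A \<Longrightarrow> tautology A \<Longrightarrow> S5 A"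
| ax_K: "purely_modal A \<Longrightarrow> purely_modal B \<Longrightarrow>
    S5 (Imp (Box (Imp A B)) (Imp (Box A) (Box B)))"
| ax_T: "purely_modal A \<Longrightarrow> S5 (Imp (Box A) A)"
| ax_4: "purely_modal A \<Longrightarrow> S5 (Imp (Box A) (Box (Box A)))"
| ax_5: "purely_modal A \<Longrightarrow> S5 (Imp (Dia A) (Box (Dia A)))"
| mp: "S5 (Imp A B) \<Longrightarrow> S5 A \<Longrightarrow> S5 B"
| nec: "S5 A \<Longrightarrow> S5 (Box A)"

end

(* Both systems are compared with truth in Carnap models: a set of valuations in which the modal
   operators quantify over the whole set.  Reading the past operators like the future ones makes
   every rule of DKS5 sound.  Conversely, backward proof search in DKS5 ends if the box rule is
   only applied to a box A for which A occurs nowhere in the tree.  In a saturated tree, 5_b and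
   4_c copy each diamond formula to the root and from there to every node, and so the nodes form
   a Carnap model refuting the root.  S5 is complete for Carnap models by the canonical model
   restricted to the points accessible from one maximal consistent set. *)

theory Submission imports Defs begin

section \<open>Carnap models\<close>

text \<open>A world is nothing more than its set of true atoms, so points with the same atoms are
  merged. Truth of a modal formula does not depend on \<open>w\<close>.\<close>

primrec sat :: "'a set set \<Rightarrow> 'a set \<Rightarrow> 'a fm \<Rightarrow> bool" where
  "sat W w (Pos a) \<longleftrightarrow> a \<in> w"
| "sat W w (Neg a) \<longleftrightarrow> a \<notin> w"
| "sat W w (Or A B) \<longleftrightarrow> sat W w A \<or> sat W w B"
| "sat W w (And A B) \<longleftrightarrow> sat W w A \<and> sat W w B"
| "sat W w (Box A) \<longleftrightarrow> (\<forall>u\<in>W. sat W u A)"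
| "sat W w (BBox A) \<longleftrightarrow> (\<forall>u\<in>W. sat W u A)"
| "sat W w (Dia A) \<longleftrightarrow> (\<exists>u\<in>W. sat W u A)"
| "sat W w (BDia A) \<longleftrightarrow> (\<exists>u\<in>W. sat W u A)"

definition valid :: "'a fm \<Rightarrow> bool" where
  "valid A \<longleftrightarrow> (\<forall>W. \<forall>w\<in>W. sat W w A)"

lemma sat_dual [simp]: "sat W w (dual A) \<longleftrightarrow> \<not> sat W w A"
  by (induction A arbitrary: w) auto

lemma sat_Imp [simp]: "sat W w (Imp A B) \<longleftrightarrow> (sat W w A \<longrightarrow> sat W w B)"
  by (auto simp: Imp_def)

lemma boolean_valuation_sat: "boolean_valuation (sat W w)"
  by (simp add: boolean_valuation_def)

section \<open>Soundness of both systems for Carnap models\<close>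

lemma S5_valid: "S5 A \<Longrightarrow> valid A"
proof (induction rule: S5.induct)
  case (taut A)
  then show ?case
    using boolean_valuation_sat by (auto simp: valid_def tautology_def)
qed (auto simp: valid_def)

text \<open>The world is bound on the right because recursion through a multiset supplies only
  \<open>image_mset (holds W) \<Gamma>\<close>, whose members are then evaluated at other worlds.
  \<open>Black\<close> is given a value because sequents of \<open>DKS5\<close> range over the full
  tense language.\<close>

primrec holds :: "'a set set \<Rightarrow> 'a struct \<Rightarrow> 'a set \<Rightarrow> bool" where
  "holds W (Form A) = (\<lambda>w. sat W w A)"
| "holds W (White \<Gamma>) = (\<lambda>w. \<forall>u\<in>W. \<exists>f\<in>#image_mset (holds W) \<Gamma>. f u)"
| "holds W (Black \<Gamma>) = (\<lambda>w. \<forall>u\<in>W. \<exists>f\<in>#image_mset (holds W) \<Gamma>. f u)"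

definition seq_holds :: "'a set set \<Rightarrow> 'a set \<Rightarrow> 'a seq \<Rightarrow> bool" where
  "seq_holds W w \<Gamma> \<longleftrightarrow> (\<exists>s\<in>#\<Gamma>. holds W s w)"

lemma holds_White [simp]: "holds W (White \<Gamma>) w \<longleftrightarrow> (\<forall>u\<in>W. seq_holds W u \<Gamma>)"
  and holds_Black [simp]: "holds W (Black \<Gamma>) w \<longleftrightarrow> (\<forall>u\<in>W. seq_holds W u \<Gamma>)"
  by (auto simp: seq_holds_def)

declare holds.simps(2,3) [simp del]

lemma seq_holds_simps [simp]:
  "\<not> seq_holds W w {#}"
  "seq_holds W w (add_mset s \<Gamma>) \<longleftrightarrow> holds W s w \<or> seq_holds W w \<Gamma>"
  "seq_holds W w (\<Gamma> + \<Delta>) \<longleftrightarrow> seq_holds W w \<Gamma> \<or> seq_holds W w \<Delta>"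
  by (auto simp: seq_holds_def)

text \<open>The hole occurs only positively, and entering a structure moves to an arbitrary world of
  \<open>W\<close>; hence the implication is required at all worlds of \<open>W\<close>.\<close>

lemma seq_holds_fill_mono:
  assumes "w \<in> W" "seq_holds W w (fill S \<Delta>)"
    and "\<And>u. u \<in> W \<Longrightarrow> seq_holds W u \<Delta> \<Longrightarrow> seq_holds W u \<Delta>'"
  shows "seq_holds W w (fill S \<Delta>')"
  using assms(1,2) by (induction S arbitrary: w) (auto intro: assms(3))

lemma seq_holds_fill:
  assumes "w \<in> W" "\<And>u. u \<in> W \<Longrightarrow> seq_holds W u \<Delta>"
  shows "seq_holds W w (fill S \<Delta>)"
  using assms(1) by (induction S arbitrary: w) (auto intro: assms(2))

text \<open>At each level either a sibling is true and settles the claim, or both fillings hold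
  inside the structure at all worlds and the induction goes on. This combines the two premises of
  \<open>conj\<close>.\<close>

lemma seq_holds_fill_mono2:
  assumes "w \<in> W" "seq_holds W w (fill S \<Delta>)" "seq_holds W w (fill S \<Delta>')"
    and "\<And>u. u \<in> W \<Longrightarrow> seq_holds W u \<Delta> \<Longrightarrow> seq_holds W u \<Delta>' \<Longrightarrow> seq_holds W u \<Theta>"
  shows "seq_holds W w (fill S \<Theta>)"
  using assms(1-3) by (induction S arbitrary: w) (auto intro: assms(4))

text \<open>At each world of \<open>W\<close> the active part of the premises implies that of the
  conclusion. For \<open>c4\<close> and \<open>b5\<close> this is because \<open>Dia A\<close> has
  the same value at all worlds, for \<open>Tb\<close> because the world itself lies in
  \<open>W\<close>.\<close>

lemma DKS5_sound: "DKS5 \<Gamma> \<Longrightarrow> w \<in> W \<Longrightarrow> seq_holds W w \<Gamma>"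
proof (induction rule: DKS5.induct)
  case (id S a)
  then show ?case by (auto intro: seq_holds_fill)
next
  case (conj S A B)
  show ?case
    by (rule seq_holds_fill_mono2[OF _ conj.IH]) (use conj.prems in auto)
next
  case (disj S A B)
  show ?case by (rule seq_holds_fill_mono[OF _ disj.IH]) (use disj.prems in auto)
next
  case (box S A)
  show ?case by (rule seq_holds_fill_mono[OF _ box.IH]) (use box.prems in auto)
next
  case (dia1 S \<Delta> A)
  show ?case by (rule seq_holds_fill_mono[OF _ dia1.IH]) (use dia1.prems in auto)
next
  case (Tb S A)
  show ?case by (rule seq_holds_fill_mono[OF _ Tb.IH]) (use Tb.prems in auto)
next
  case (c4 S A \<Delta>)
  show ?case by (rule seq_holds_fill_mono[OF _ c4.IH]) (use c4.prems in auto)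
next
  case (b5 S \<Delta> A)
  show ?case by (rule seq_holds_fill_mono[OF _ b5.IH]) (use b5.prems in auto)
qed

lemma derivable_DKS5_valid: "derivable_DKS5 A \<Longrightarrow> valid A"
  unfolding derivable_DKS5_def valid_def using DKS5_sound by fastforce

section \<open>Completeness of DKS5\<close>

primrec plug :: "'a seq list \<Rightarrow> 'a seq \<Rightarrow> 'a seq" where
  "plug [] N = N"
| "plug (G # Gs) N = add_mset (White (plug Gs N)) G"

lemma plug_snoc: "plug (Gs @ [G]) N = plug Gs (add_mset (White N) G)"
  by (induction Gs) auto

text \<open>An equation \<open>\<Gamma> = plug Gs N\<close> addresses a node: \<open>Gs\<close>
  lists the siblings along the path from the root, and \<open>N\<close> is the whole content of the
  node. A context of \<open>DKS5\<close> arises by splitting that content into siblings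
  \<open>G\<close> and an active part.\<close>

lemma plug_eq_fill: "plug Gs (G + N) = fill (foldr InWhite Gs (Hole G)) N"
  by (induction Gs) auto

text \<open>\<open>Black\<close> contributes nothing, in accordance with \<open>plug\<close>, which
  descends through \<open>White\<close> only.\<close>

primrec forms :: "'a struct \<Rightarrow> 'a fm set" where
  "forms (Form A) = {A}"
| "forms (White \<Gamma>) = \<Union> (set_mset (image_mset forms \<Gamma>))"
| "forms (Black \<Gamma>) = {}"

lemma forms_plug_mono:
  "forms (White N) \<subseteq> forms (White N') \<Longrightarrow>
    forms (White (plug Gs N)) \<subseteq> forms (White (plug Gs N'))"
  by (induction Gs) auto

lemma forms_plug_subset: "forms (White N) \<subseteq> forms (White (plug Gs N))"
  by (induction Gs) auto

lemma forms_plug_le: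
  "forms (White N') \<subseteq> forms (White N) \<union> X \<Longrightarrow>
    forms (White (plug Gs N')) \<subseteq> forms (White (plug Gs N)) \<union> X"
  by (induction Gs) auto

lemma forms_obtain_node:
  "A \<in> forms (White \<Gamma>) \<Longrightarrow> \<exists>Gs N. \<Gamma> = plug Gs N \<and> Form A \<in># N"
proof (induction "White \<Gamma>" arbitrary: \<Gamma> rule: struct.induct)
  case (White \<Gamma>)
  then obtain s where s: "s \<in># \<Gamma>" "A \<in> forms s" by auto
  show ?case
  proof (cases s)
    case (Form B)
    then show ?thesis using s by (intro exI[of _ "[]"]) auto
  next
    case (White \<Delta>)
    then obtain Gs N where "\<Delta> = plug Gs N" "Form A \<in># N"
      using White.hyps s by blast
    then show ?thesis
      using s \<open>s = White \<Delta>\<close> by (intro exI[of _ "(\<Gamma> - {#White \<Delta>#}) # Gs"] exI[of _ N]) auto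
  qed (use s in auto)
qed

section \<open>A measure for backward proof search\<close>

abbreviation labels :: "'a seq \<Rightarrow> 'a fm set" where
  "labels \<Gamma> \<equiv> {A. Form A \<in># \<Gamma>}"

lemma labels_subset_forms: "labels \<Gamma> \<subseteq> forms (White \<Gamma>)"
  by force

text \<open>For \<open>k = card F\<close> and labels within \<open>F\<close>, this counts the pairs
  of a node and a formula of \<open>F\<close> that is still absent from it.\<close>

primrec missing :: "nat \<Rightarrow> 'a struct \<Rightarrow> nat" where
  "missing k (Form A) = 0"
| "missing k (White \<Gamma>) = (k - card (labels \<Gamma>)) + sum_mset (image_mset (missing k) \<Gamma>)"
| "missing k (Black \<Gamma>) = 0"

text \<open>Changing one node alters the total only by the contribution of its subtree. The form
  with sums on both sides avoids truncated subtraction.\<close>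

lemma missing_plug:
  "missing k (White (plug Gs N')) + missing k (White N)
    = missing k (White (plug Gs N)) + missing k (White N')"
  by (induction Gs) auto

text \<open>An occurrence of \<open>A\<close> at any node counts as a witness, since a box in a
  Carnap model quantifies over all worlds.\<close>

definition unwitnessed :: "'a fm set \<Rightarrow> 'a seq \<Rightarrow> 'a fm set" where
  "unwitnessed F \<Gamma> = {A. Box A \<in> F \<and> A \<notin> forms (White \<Gamma>)}"

text \<open>
  The box rule adds a node, which costs at most \<open>card F\<close> and witnesses a new formula.
\<close>

definition rank :: "'a fm set \<Rightarrow> 'a seq \<Rightarrow> nat" where
  "rank F \<Gamma> = Suc (card F) * card (unwitnessed F \<Gamma>) + missing (card F) (White \<Gamma>)"

lemma finite_unwitnessed: "finite F \<Longrightarrow> finite (unwitnessed F \<Gamma>)"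
  by (rule finite_subset[of _ "Box -` F"]) (auto simp: unwitnessed_def inj_def finite_vimageI)

lemma labels_finite: "finite (labels \<Gamma>)"
proof -
  have "labels \<Gamma> = Form -` set_mset \<Gamma>" by auto
  then show ?thesis by (simp add: finite_vimageI inj_def)
qed

text \<open>No formula becomes unwitnessed, and the deficit of the node drops strictly. With a
  multiset \<open>\<Phi>\<close> the rule for \<open>Or\<close> can add two formulae in one
  step.\<close>

lemma rank_add_forms:
  assumes "finite F" "forms (White (plug Gs N)) \<subseteq> F"
    and "set_mset \<Phi> \<subseteq> F" "\<not> set_mset \<Phi> \<subseteq> labels N"
  shows "rank F (plug Gs (N + image_mset Form \<Phi>)) < rank F (plug Gs N)"
    and "forms (White (plug Gs (N + image_mset Form \<Phi>))) \<subseteq> F"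
proof -
  let ?N = "N + image_mset Form \<Phi>"
  have sub: "forms (White (plug Gs N)) \<subseteq> forms (White (plug Gs ?N))"
    by (rule forms_plug_mono) auto
  show le: "forms (White (plug Gs ?N)) \<subseteq> F"
    using forms_plug_le[of ?N N "set_mset \<Phi>" Gs] assms(2,3) by auto
  have "card (unwitnessed F (plug Gs ?N)) \<le> card (unwitnessed F (plug Gs N))"
    using sub by (intro card_mono finite_unwitnessed assms(1)) (auto simp: unwitnessed_def)
  then have 1: "Suc (card F) * card (unwitnessed F (plug Gs ?N))
      \<le> Suc (card F) * card (unwitnessed F (plug Gs N))"
    by (rule mult_le_mono2)
  have lab: "labels ?N = labels N \<union> set_mset \<Phi>" by auto
  have "card (labels N) < card (labels ?N)"
    using assms(4) lab labels_finite[of ?N] by (intro psubset_card_mono) auto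
  \<comment> \<open>This bound keeps the truncated difference in \<open>missing\<close> strictly
    decreasing.\<close>
  moreover have "card (labels ?N) \<le> card F"
    using labels_subset_forms[of ?N] forms_plug_subset[of ?N Gs] le
    by (intro card_mono assms(1)) blast
  moreover have "sum_mset (image_mset (missing k) (image_mset Form \<Phi>)) = 0" for k
    by (induction \<Phi>) auto
  then have "missing k (White ?N) = (k - card (labels ?N)) + sum_mset (image_mset (missing k) N)" for k
    by (simp only: missing.simps image_mset_union sum_mset.union add_0_right)
  ultimately have "missing (card F) (White ?N) < missing (card F) (White N)"
    by (simp only: missing.simps)
  then have "missing (card F) (White (plug Gs ?N)) < missing (card F) (White (plug Gs N))"
    using missing_plug[of "card F" Gs ?N N] by linarith
  then show "rank F (plug Gs ?N) < rank F (plug Gs N)"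
    using 1 by (simp add: rank_def)
qed

lemma rank_add_node:
  assumes "finite F" "forms (White (plug Gs N)) \<subseteq> F"
    and "A \<in> unwitnessed F (plug Gs N)" "A \<in> F"
  defines "N' \<equiv> add_mset (White {#Form A#}) N"
  shows "rank F (plug Gs N') < rank F (plug Gs N)"
    and "forms (White (plug Gs N')) \<subseteq> F"
proof -
  have sub: "forms (White (plug Gs N)) \<subseteq> forms (White (plug Gs N'))"
    by (rule forms_plug_mono) (auto simp: N'_def)
  show "forms (White (plug Gs N')) \<subseteq> F"
    using forms_plug_le[of N' N "{A}" Gs] assms(2,4) by (auto simp: N'_def)
  have "A \<in> forms (White (plug Gs N'))"
    using forms_plug_subset[of N' Gs] by (auto simp: N'_def)
  then have "card (unwitnessed F (plug Gs N')) < card (unwitnessed F (plug Gs N))"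
    using sub assms(3)
    by (intro psubset_card_mono finite_unwitnessed assms(1)) (auto simp: unwitnessed_def)
  then have 1: "Suc (card F) * Suc (card (unwitnessed F (plug Gs N')))
      \<le> Suc (card F) * card (unwitnessed F (plug Gs N))"
    by (intro mult_le_mono2) simp
  \<comment> \<open>The added structure is not a label of its parent, so only the deficit of the new
    node is added.\<close>
  have "labels N' = labels N" by (auto simp: N'_def)
  then have "missing (card F) (White N') \<le> card F + missing (card F) (White N)"
    by (simp add: N'_def)
  then have "missing (card F) (White (plug Gs N')) \<le> card F + missing (card F) (White (plug Gs N))"
    using missing_plug[of "card F" Gs N' N] by linarith
  then show "rank F (plug Gs N') < rank F (plug Gs N)"
    using 1 by (simp add: rank_def)
qed

section \<open>Saturated trees and their countermodels\<close>

definition subformula_closed :: "'a fm set \<Rightarrow> bool" where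
  "subformula_closed F \<longleftrightarrow>
    (\<forall>A B. Or A B \<in> F \<longrightarrow> A \<in> F \<and> B \<in> F) \<and> (\<forall>A B. And A B \<in> F \<longrightarrow> A \<in> F \<and> B \<in> F) \<and>
    (\<forall>A. Box A \<in> F \<longrightarrow> A \<in> F) \<and> (\<forall>A. Dia A \<in> F \<longrightarrow> A \<in> F)"

text \<open>After the clause excluding \<open>id\<close>, each clause says that a rule applied
  backward would add nothing. The witness of a box may be anywhere in \<open>\<Gamma>\<close>. The
  equivalence for \<open>Dia\<close> combines \<open>c4\<close>, from parent to child, with
  \<open>b5\<close>, from child to parent.\<close>

definition saturated :: "'a seq \<Rightarrow> bool" where
  "saturated \<Gamma> \<longleftrightarrow> (\<forall>Gs N. \<Gamma> = plug Gs N \<longrightarrow>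
    (\<forall>a. \<not> (Form (Pos a) \<in># N \<and> Form (Neg a) \<in># N)) \<and>
    (\<forall>A B. Form (And A B) \<in># N \<longrightarrow> Form A \<in># N \<or> Form B \<in># N) \<and>
    (\<forall>A B. Form (Or A B) \<in># N \<longrightarrow> Form A \<in># N \<and> Form B \<in># N) \<and>
    (\<forall>A. Form (Box A) \<in># N \<longrightarrow> A \<in> forms (White \<Gamma>)) \<and>
    (\<forall>A. Form (Dia A) \<in># N \<longrightarrow> Form A \<in># N) \<and>
    (\<forall>A \<Delta>. White \<Delta> \<in># N \<longrightarrow> (Form (Dia A) \<in># N \<longleftrightarrow> Form (Dia A) \<in># \<Delta>)))"

text \<open>Induction from the end of the path peels off the edge to the parent, whose content is
  \<open>add_mset (White N) G\<close>; the last clause of \<open>saturated\<close> handles that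
  edge.\<close>

lemma saturated_Dia_root:
  assumes "saturated \<Gamma>"
  shows "\<Gamma> = plug Gs N \<Longrightarrow> Form (Dia A) \<in># N \<longleftrightarrow> Form (Dia A) \<in># \<Gamma>"
proof (induction Gs arbitrary: N rule: rev_induct)
  case (snoc G Gs)
  let ?M = "add_mset (White N) G"
  have "\<Gamma> = plug Gs ?M" using snoc.prems by (simp add: plug_snoc)
  moreover have "Form (Dia A) \<in># ?M \<longleftrightarrow> Form (Dia A) \<in># N"
    using assms \<open>\<Gamma> = plug Gs ?M\<close> unfolding saturated_def by (metis union_single_eq_member)
  ultimately show ?case using snoc.IH by blast
qed simp

text \<open>An atom is true at a node iff its \<open>Pos\<close> is absent there. This refutes
  \<open>Pos\<close> labels at once, and \<open>Neg\<close> labels because no node contains a clash.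
  The induction on \<open>B\<close> treats all nodes simultaneously, as the modal cases change the
  node.\<close>

lemma saturated_countermodel:
  assumes "saturated \<Gamma>" "\<And>A. A \<in> forms (White \<Gamma>) \<Longrightarrow> purely_modal A"
  defines "W \<equiv> {{a. Form (Pos a) \<notin># N} | Gs N. \<Gamma> = plug Gs N}"
  shows "\<Gamma> = plug Gs N \<Longrightarrow> Form B \<in># N \<Longrightarrow> \<not> sat W {a. Form (Pos a) \<notin># N} B"
proof (induction B arbitrary: Gs N)
  case (Neg a)
  then have "Form (Pos a) \<notin># N" using assms(1) unfolding saturated_def by blast
  then show ?case by simp
next
  case (Or A B)
  then have "Form A \<in># N" "Form B \<in># N" using assms(1) unfolding saturated_def by blast+
  then show ?case using Or.IH[OF Or.prems(1)] by simp
next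
  case (And A B)
  then have "Form A \<in># N \<or> Form B \<in># N" using assms(1) unfolding saturated_def by blast
  then show ?case using And.IH[OF And.prems(1)] by auto
next
  case (Box A)
  then have "A \<in> forms (White \<Gamma>)" using assms(1) unfolding saturated_def by blast
  then obtain Hs M where "\<Gamma> = plug Hs M" "Form A \<in># M"
    using forms_obtain_node by blast
  then have "{a. Form (Pos a) \<notin># M} \<in> W" "\<not> sat W {a. Form (Pos a) \<notin># M} A"
    using Box.IH unfolding W_def by blast+
  then show ?case by auto
next
  case (Dia A)
  \<comment> \<open>The diamond passes to the root and from there to every node, where the clause
    for \<open>Tb\<close> supplies its body.\<close>
  have "Form A \<in># M" if "\<Gamma> = plug Hs M" for Hs M
  proof -
    have "Form (Dia A) \<in># M"
      using saturated_Dia_root[OF assms(1)] that Dia.prems by blast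
    then show ?thesis using assms(1) that unfolding saturated_def by blast
  qed
  then have "\<not> sat W w A" if "w \<in> W" for w
    using Dia.IH that unfolding W_def by blast
  then show ?case by simp
next
  case (BBox A)
  then have "BBox A \<in> forms (White \<Gamma>)"
    using labels_subset_forms[of N] forms_plug_subset[of N Gs] by blast
  then show ?case using assms(2)[of "BBox A"] by simp
next
  case (BDia A)
  then have "BDia A \<in> forms (White \<Gamma>)"
    using labels_subset_forms[of N] forms_plug_subset[of N Gs] by blast
  then show ?case using assms(2)[of "BDia A"] by simp
qed simp

section \<open>The rules of DKS5 at an addressed node\<close>

lemma DKS5_plug_id:
  assumes "Form (Pos a) \<in># N" "Form (Neg a) \<in># N"
  shows "DKS5 (plug Gs N)"
proof -
  obtain M where "N = M + {#Form (Pos a), Form (Neg a)#}"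
    using assms by (auto dest!: multi_member_split simp: add_eq_conv_ex)
  then show ?thesis
    using DKS5.id[of "foldr InWhite Gs (Hole M)" a] by (simp only: plug_eq_fill)
qed

text \<open>The principal formula is taken out of \<open>N\<close> and the remainder becomes the
  siblings of the hole. The following rules are transferred in the same way.\<close>

lemma DKS5_plug_conj:
  "Form (And A B) \<in># N \<Longrightarrow> DKS5 (plug Gs (N + {#Form A#})) \<Longrightarrow>
    DKS5 (plug Gs (N + {#Form B#})) \<Longrightarrow> DKS5 (plug Gs N)"
  using DKS5.conj[of "foldr InWhite Gs (Hole (N - {#Form (And A B)#}))" A B]
  by (simp add: plug_eq_fill[symmetric] add_mset_commute[of "Form (And A B)"])

lemma DKS5_plug_disj:
  "Form (Or A B) \<in># N \<Longrightarrow> DKS5 (plug Gs (N + {#Form A, Form B#})) \<Longrightarrow> DKS5 (plug Gs N)"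
  using DKS5.disj[of "foldr InWhite Gs (Hole (N - {#Form (Or A B)#}))" A B]
  by (simp add: plug_eq_fill[symmetric] add_mset_commute[of "Form (Or A B)"])

lemma DKS5_plug_box:
  "Form (Box A) \<in># N \<Longrightarrow> DKS5 (plug Gs (add_mset (White {#Form A#}) N)) \<Longrightarrow>
    DKS5 (plug Gs N)"
  using DKS5.box[of "foldr InWhite Gs (Hole (N - {#Form (Box A)#}))" A]
  by (simp add: plug_eq_fill[symmetric] add_mset_commute[of "Form (Box A)"])

lemma DKS5_plug_Tb:
  "Form (Dia A) \<in># N \<Longrightarrow> DKS5 (plug Gs (N + {#Form A#})) \<Longrightarrow> DKS5 (plug Gs N)"
  using DKS5.Tb[of "foldr InWhite Gs (Hole (N - {#Form (Dia A)#}))" A]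
  by (simp add: plug_eq_fill[symmetric] add_mset_commute[of "Form (Dia A)"])

text \<open>The rule reads the parent but changes the child, so the addressed node is the child and
  \<open>G\<close> is the rest of the parent.\<close>

lemma DKS5_plug_c4:
  assumes "Form (Dia A) \<in># G" "DKS5 (plug (Gs @ [G]) (\<Delta> + {#Form (Dia A)#}))"
  shows "DKS5 (plug (Gs @ [G]) \<Delta>)"
  using assms DKS5.c4[of "foldr InWhite Gs (Hole (G - {#Form (Dia A)#}))" A \<Delta>]
  by (simp add: plug_eq_fill[symmetric] plug_snoc add_mset_commute[of "Form (Dia A)"] del: foldr_append)

lemma DKS5_plug_b5:
  assumes "White \<Delta> \<in># N" "Form (Dia A) \<in># \<Delta>" "DKS5 (plug Gs (N + {#Form (Dia A)#}))"
  shows "DKS5 (plug Gs N)"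
  using assms
    DKS5.b5[of "foldr InWhite Gs (Hole (N - {#White \<Delta>#}))" "\<Delta> - {#Form (Dia A)#}" A]
  by (simp add: plug_eq_fill[symmetric] add_mset_commute[of "White \<Delta>"])

text \<open>Induction on the rank takes the place of a search procedure. The countermodel refutes
  only the root labels; these can only grow in backward steps, so it passes from a premise down to
  the conclusion.\<close>

lemma DKS5_or_countermodel:
  assumes F: "finite F" "subformula_closed F" "\<And>A. A \<in> F \<Longrightarrow> purely_modal A"
  shows "forms (White \<Gamma>) \<subseteq> F \<Longrightarrow>
    DKS5 \<Gamma> \<or> (\<exists>W. \<exists>w\<in>W. \<forall>B\<in>labels \<Gamma>. \<not> sat W w B)"
proof (induction "rank F \<Gamma>" arbitrary: \<Gamma> rule: less_induct)
  case less
  show ?case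
  proof (rule disjCI)
    assume neg: "\<not> (\<exists>W. \<exists>w\<in>W. \<forall>B\<in>labels \<Gamma>. \<not> sat W w B)"
    \<comment> \<open>A countermodel of \<open>\<Gamma>'\<close> would also refute the fewer labels
      of \<open>\<Gamma>\<close>, contrary to \<open>neg\<close>, so derivability remains.\<close>
    have IH: "DKS5 \<Gamma>'"
      if "rank F \<Gamma>' < rank F \<Gamma>" "forms (White \<Gamma>') \<subseteq> F" "labels \<Gamma> \<subseteq> labels \<Gamma>'" for \<Gamma>'
      using less.hyps[OF that(1,2)] neg that(3) by blast
    have labels_mono: "labels (plug Gs N) \<subseteq> labels (plug Gs (N + M))" for Gs and N M :: "'a seq"
      by (cases Gs) auto
    have extend: "DKS5 (plug Gs (N + image_mset Form \<Phi>))"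
      if "\<Gamma> = plug Gs N" "set_mset \<Phi> \<subseteq> F" "\<not> set_mset \<Phi> \<subseteq> labels N" for Gs N \<Phi>
      using rank_add_forms[OF F(1) _ that(2,3)] labels_mono less.prems that(1) by (intro IH) auto
    have ext1: "DKS5 (plug Gs (N + {#Form A#}))"
      if "\<Gamma> = plug Gs N" "A \<in> F" "Form A \<notin># N" for Gs N A
      using extend[of Gs N "{#A#}"] that by auto
    show "DKS5 \<Gamma>"
    proof (rule ccontr)
      assume nd: "\<not> DKS5 \<Gamma>"
      \<comment> \<open>If a clause failed, some rule would conclude \<open>\<Gamma>\<close> with
        all its premises of smaller rank and hence derivable.\<close>
      have "saturated \<Gamma>"
        unfolding saturated_def
      proof (intro allI impI conjI)
        fix Gs N
        assume \<Gamma>: "\<Gamma> = plug Gs N"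
        have nd': "\<not> DKS5 (plug Gs N)"
          using nd \<Gamma> by simp
        have inF: "B \<in> F" if "Form B \<in># N" for B
          using that labels_subset_forms[of N] forms_plug_subset[of N Gs] less.prems \<Gamma> by blast
        show "\<not> (Form (Pos a) \<in># N \<and> Form (Neg a) \<in># N)" for a
          using DKS5_plug_id[of a N Gs] nd' by blast
        show "Form A \<in># N \<or> Form B \<in># N" if "Form (And A B) \<in># N" for A B
        proof -
          have "A \<in> F" "B \<in> F"
            using inF[OF that] F(2) unfolding subformula_closed_def by blast+
          then show ?thesis using DKS5_plug_conj[OF that, of Gs] ext1[OF \<Gamma>] nd' by blast
        qed
        \<comment> \<open>Both disjuncts are added together; \<open>extend\<close> asks only that at
          least one be new.\<close>
        have "Form A \<in># N \<and> Form B \<in># N" if "Form (Or A B) \<in># N" for A B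
        proof -
          have "A \<in> F" "B \<in> F"
            using inF[OF that] F(2) unfolding subformula_closed_def by blast+
          then show ?thesis
            using DKS5_plug_disj[OF that, of Gs] extend[OF \<Gamma>, of "{#A, B#}"] nd' by auto
        qed
        then show "Form A \<in># N" "Form B \<in># N" if "Form (Or A B) \<in># N" for A B
          using that by blast+
        show "A \<in> forms (White \<Gamma>)" if "Form (Box A) \<in># N" for A
        proof (rule ccontr)
          assume "A \<notin> forms (White \<Gamma>)"
          then have "A \<in> unwitnessed F (plug Gs N)" "A \<in> F"
            using inF[OF that] F(2) \<Gamma> unfolding unwitnessed_def subformula_closed_def by blast+
          then have "DKS5 (plug Gs (add_mset (White {#Form A#}) N))"
            using rank_add_node[OF F(1)] less.prems \<Gamma> labels_mono[of Gs N "{#White {#Form A#}#}"]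
            by (intro IH) auto
          then show False using DKS5_plug_box[OF that] nd' by blast
        qed
        show "Form A \<in># N" if "Form (Dia A) \<in># N" for A
        proof -
          have "A \<in> F"
            using inF[OF that] F(2) unfolding subformula_closed_def by blast
          then show ?thesis using DKS5_plug_Tb[OF that, of Gs] ext1[OF \<Gamma>] nd' by blast
        qed
        fix A \<Delta>
        assume \<Delta>: "White \<Delta> \<in># N"
        \<comment> \<open>The child is addressed as a node of its own, so that \<open>ext1\<close>
          can add the diamond to it.\<close>
        define G where "G = N - {#White \<Delta>#}"
        have \<Gamma>': "\<Gamma> = plug (Gs @ [G]) \<Delta>"
          using \<Gamma> \<Delta> by (simp add: plug_snoc G_def)
        show "Form (Dia A) \<in># N \<longleftrightarrow> Form (Dia A) \<in># \<Delta>"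
        proof
          assume "Form (Dia A) \<in># N"
          moreover from this have "Form (Dia A) \<in># G"
            by (auto simp: G_def in_diff_count)
          ultimately show "Form (Dia A) \<in># \<Delta>"
            using DKS5_plug_c4[of A G Gs \<Delta>] ext1[OF \<Gamma>'] inF nd[unfolded \<Gamma>'] by blast
        next
          assume *: "Form (Dia A) \<in># \<Delta>"
          then have "Dia A \<in> F"
            using labels_subset_forms[of \<Delta>] forms_plug_subset[of \<Delta> "Gs @ [G]"] less.prems \<Gamma>'
            by blast
          then show "Form (Dia A) \<in># N"
            using DKS5_plug_b5[OF \<Delta> *, of Gs] ext1[OF \<Gamma>] nd' by blast
        qed
      qed
      moreover have "purely_modal A" if "A \<in> forms (White \<Gamma>)" for A
        using that F(3) less.prems by blast
      \<comment> \<open>The root is the node with the empty path.\<close>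
      ultimately have "\<forall>B\<in>labels \<Gamma>. \<not> sat {{a. Form (Pos a) \<notin># N} | Gs N. \<Gamma> = plug Gs N}
          {a. Form (Pos a) \<notin># \<Gamma>} B"
        using saturated_countermodel[of \<Gamma> "[]" \<Gamma>] by auto
      moreover have "{a. Form (Pos a) \<notin># \<Gamma>} \<in> {{a. Form (Pos a) \<notin># N} | Gs N. \<Gamma> = plug Gs N}"
        by (intro CollectI exI[of _ "[]"] exI[of _ \<Gamma>]) simp
      ultimately show False using neg by blast
    qed
  qed
qed

section \<open>Finite search space of subformulae\<close>

primrec subformulas :: "'a fm \<Rightarrow> 'a fm set" where
  "subformulas (Pos a) = {Pos a}"
| "subformulas (Neg a) = {Neg a}"
| "subformulas (Or A B) = insert (Or A B) (subformulas A \<union> subformulas B)"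
| "subformulas (And A B) = insert (And A B) (subformulas A \<union> subformulas B)"
| "subformulas (Box A) = insert (Box A) (subformulas A)"
| "subformulas (BBox A) = insert (BBox A) (subformulas A)"
| "subformulas (Dia A) = insert (Dia A) (subformulas A)"
| "subformulas (BDia A) = insert (BDia A) (subformulas A)"

lemma subformulas_refl: "A \<in> subformulas A"
  by (cases A) auto

lemma finite_subformulas: "finite (subformulas A)"
  by (induction A) auto

lemma subformulas_trans: "B \<in> subformulas A \<Longrightarrow> subformulas B \<subseteq> subformulas A"
  by (induction A) auto

lemma subformula_closed_subformulas: "subformula_closed (subformulas A)"
proof -
  have "C \<in> subformulas A" if "B \<in> subformulas A" "C \<in> subformulas B" for B C
    using that subformulas_trans by blast
  moreover have "B \<in> subformulas (Or B C)" "C \<in> subformulas (Or B C)"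
    "B \<in> subformulas (And B C)" "C \<in> subformulas (And B C)"
    "B \<in> subformulas (Box B)" "B \<in> subformulas (Dia B)" for B C :: "'a fm"
    by (simp_all add: subformulas_refl)
  ultimately show ?thesis
    unfolding subformula_closed_def by meson
qed

lemma purely_modal_subformulas: "purely_modal A \<Longrightarrow> B \<in> subformulas A \<Longrightarrow> purely_modal B"
  by (induction A) auto

lemma valid_derivable_DKS5:
  assumes "purely_modal A" "valid A"
  shows "derivable_DKS5 A"
  using DKS5_or_countermodel[OF finite_subformulas subformula_closed_subformulas
      purely_modal_subformulas[OF assms(1)], where \<Gamma> = "{#Form A#}"] assms(2)
  by (auto simp: subformulas_refl derivable_DKS5_def valid_def)

section \<open>Completeness of S5\<close>

lemma purely_modal_dual [simp]: "purely_modal (dual A) = purely_modal A"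
  by (induction A) auto

lemma dual_dual [simp]: "dual (dual A) = A"
  by (induction A) auto

lemma purely_modal_Imp [simp]: "purely_modal (Imp A B) \<longleftrightarrow> purely_modal A \<and> purely_modal B"
  by (auto simp: Imp_def)

lemma S5_purely_modal: "S5 A \<Longrightarrow> purely_modal A"
  by (induction rule: S5.induct) auto

abbreviation imps :: "'a fm list \<Rightarrow> 'a fm \<Rightarrow> 'a fm" where
  "imps L A \<equiv> foldr Imp L A"

lemma purely_modal_imps [simp]:
  "purely_modal (imps L A) \<longleftrightarrow> (\<forall>B\<in>set L. purely_modal B) \<and> purely_modal A"
  by (induction L) auto

lemma boolean_valuation_simps [simp]:
  assumes "boolean_valuation v"
  shows "v (Or A B) \<longleftrightarrow> v A \<or> v B" "v (And A B) \<longleftrightarrow> v A \<and> v B" "v (dual A) \<longleftrightarrow> \<not> v A"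
    "v (Imp A B) \<longleftrightarrow> (v A \<longrightarrow> v B)"
  using assms by (auto simp: boolean_valuation_def Imp_def)

lemma boolean_valuation_imps [simp]:
  "boolean_valuation v \<Longrightarrow> v (imps L A) \<longleftrightarrow> ((\<forall>B\<in>set L. v B) \<longrightarrow> v A)"
  by (induction L) auto

text \<open>Assumptions are discharged inside a theorem of \<open>S5\<close>. As additional axioms
  they would fall under \<open>nec\<close>, and the deduction theorem would fail.\<close>

definition derives :: "'a fm set \<Rightarrow> 'a fm \<Rightarrow> bool" where
  "derives X A \<longleftrightarrow> (\<exists>L. set L \<subseteq> X \<and> S5 (imps L A))"

lemma derives_S5: "S5 A \<Longrightarrow> derives X A"
  unfolding derives_def by (intro exI[of _ "[]"]) simp

lemma derives_purely_modal: "derives X A \<Longrightarrow> purely_modal A"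
  unfolding derives_def using S5_purely_modal by fastforce

lemma derives_assumption: "A \<in> X \<Longrightarrow> purely_modal A \<Longrightarrow> derives X A"
  unfolding derives_def by (intro exI[of _ "[A]"]) (auto intro!: S5.taut simp: tautology_def)

lemma derives_mp:
  assumes "derives X (Imp A B)" "derives X A"
  shows "derives X B"
proof -
  obtain L M where LM: "set L \<subseteq> X" "S5 (imps L (Imp A B))" "set M \<subseteq> X" "S5 (imps M A)"
    using assms unfolding derives_def by blast
  have "S5 (Imp (imps L (Imp A B)) (Imp (imps M A) (imps (L @ M) B)))"
    using LM(2,4)[THEN S5_purely_modal]
    by (intro S5.taut) (auto simp: tautology_def simp del: foldr_append)
  then have "S5 (imps (L @ M) B)"
    using LM(2,4) S5.mp by blast
  then show ?thesis using LM(1,3) unfolding derives_def by (intro exI[of _ "L @ M"]) simp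
qed

lemma derives_deduction:
  assumes "derives (insert B X) A" "purely_modal B"
  shows "derives X (Imp B A)"
proof -
  obtain L where L: "set L \<subseteq> insert B X" "S5 (imps L A)"
    using assms(1) unfolding derives_def by blast
  \<comment> \<open>\<open>B\<close> may occur anywhere in \<open>L\<close> and repeatedly; all its
    occurrences are replaced by one innermost premise, which is a propositional
    rearrangement.\<close>
  let ?L = "filter (\<lambda>C. C \<noteq> B) L"
  have "S5 (Imp (imps L A) (imps ?L (Imp B A)))"
    using S5_purely_modal[OF L(2)] assms(2) by (intro S5.taut) (auto simp: tautology_def)
  then have "S5 (imps ?L (Imp B A))"
    using L(2) S5.mp by blast
  then show ?thesis using L(1) unfolding derives_def by (intro exI[of _ ?L]) auto
qed

section \<open>Maximal consistent sets of purely modal formulae\<close>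

definition mcs :: "'a fm set \<Rightarrow> bool" where
  "mcs X \<longleftrightarrow> (\<forall>A. derives X A \<longrightarrow> A \<in> X) \<and>
    (\<forall>A. purely_modal A \<longrightarrow> (dual A \<in> X \<longleftrightarrow> A \<notin> X)) \<and> (\<forall>A\<in>X. purely_modal A)"

text \<open>Zorn's lemma yields a set that is maximal among those not deriving \<open>G\<close>;
  underivability of \<open>G\<close> takes the place of consistency.\<close>

lemma lindenbaum:
  assumes X: "\<And>A. A \<in> X \<Longrightarrow> purely_modal A" "\<not> derives X G" and G: "purely_modal G"
  shows "\<exists>Y. X \<subseteq> Y \<and> mcs Y \<and> G \<notin> Y"
proof -
  let ?\<A> = "{Y. X \<subseteq> Y \<and> Y \<subseteq> Collect purely_modal \<and> \<not> derives Y G}"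
  have "\<exists>Y\<in>?\<A>. \<forall>Z\<in>?\<A>. Y \<subseteq> Z \<longrightarrow> Z = Y"
  proof (rule subset_Zorn_nonempty)
    show "?\<A> \<noteq> {}" using X by blast
  next
    fix \<C>
    assume \<C>: "\<C> \<noteq> {}" "subset.chain ?\<A> \<C>"
    \<comment> \<open>A derivation uses finitely many assumptions, which already lie in one member
      of the chain.\<close>
    have "\<not> derives (\<Union>\<C>) G"
    proof
      assume "derives (\<Union>\<C>) G"
      then obtain L where L: "set L \<subseteq> \<Union>\<C>" "S5 (imps L G)"
        unfolding derives_def by blast
      obtain Y where "Y \<in> \<C>" "set L \<subseteq> Y"
        using finite_subset_Union_chain[OF _ L(1) \<C>] by auto
      then show False using L(2) \<C>(2) unfolding derives_def subset.chain_def by blast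
    qed
    then show "\<Union>\<C> \<in> ?\<A>"
      using \<C> unfolding subset.chain_def by blast
  qed
  then obtain Y where "Y \<in> ?\<A>" and *: "\<forall>Z\<in>?\<A>. Y \<subseteq> Z \<longrightarrow> Z = Y" ..
  then have Y: "X \<subseteq> Y" "Y \<subseteq> Collect purely_modal" "\<not> derives Y G"
    by simp_all
  have max: "Z = Y" if "Y \<subseteq> Z" "Z \<subseteq> Collect purely_modal" "\<not> derives Z G" for Z
    using bspec[OF *, of Z] that Y(1) by simp
  have imp: "derives Y (Imp A G)" if "purely_modal A" "A \<notin> Y" for A
  proof (rule derives_deduction[OF _ that(1)], rule ccontr)
    assume "\<not> derives (insert A Y) G"
    then show False using max[of "insert A Y"] Y(2) that by blast
  qed
  have closed: "A \<in> Y" if "derives Y A" for A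
    using imp derives_mp that Y(3) derives_purely_modal by blast
  \<comment> \<open>Left to right, a formula and its dual together would derive \<open>G\<close>.
    Right to left, if both were absent, maximality would give \<open>G\<close> from either one, and
    case distinction would derive it.\<close>
  have "dual A \<in> Y \<longleftrightarrow> A \<notin> Y" if A: "purely_modal A" for A
  proof
    assume d: "dual A \<in> Y"
    show "A \<notin> Y"
    proof
      assume "A \<in> Y"
      have "S5 (Imp A (Imp (dual A) G))"
        using A G by (intro S5.taut) (auto simp: tautology_def)
      then show False
        using derives_mp derives_S5 derives_assumption \<open>A \<in> Y\<close> d A Y(3) purely_modal_dual by metis
    qed
  next
    assume "A \<notin> Y"
    have "S5 (Imp (Imp A G) (Imp (Imp (dual A) G) G))"
      using A G by (intro S5.taut) (auto simp: tautology_def)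
    then show "dual A \<in> Y"
      using derives_mp derives_S5 imp A \<open>A \<notin> Y\<close> Y(3) purely_modal_dual by metis
  qed
  then have "mcs Y" unfolding mcs_def using closed Y(2) by blast
  moreover have "G \<notin> Y" using Y(3) derives_assumption G by blast
  ultimately show ?thesis using Y(1) by blast
qed

context
  fixes X :: "'a fm set"
  assumes X: "mcs X"
begin

lemma mcs_mp: "S5 (Imp A B) \<Longrightarrow> A \<in> X \<Longrightarrow> B \<in> X"
  using X derives_mp derives_S5 derives_assumption unfolding mcs_def by metis

lemma mcs_dual: "purely_modal A \<Longrightarrow> dual A \<in> X \<longleftrightarrow> A \<notin> X"
  using X unfolding mcs_def by blast

lemma mcs_And:
  assumes "purely_modal A" "purely_modal B"
  shows "And A B \<in> X \<longleftrightarrow> A \<in> X \<and> B \<in> X"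
proof -
  have "S5 (Imp (And A B) A)" "S5 (Imp (And A B) B)" "S5 (Imp A (Imp B (And A B)))"
    using assms by (auto intro!: S5.taut simp: tautology_def)
  moreover have "derives X (And A B)" if "A \<in> X" "B \<in> X"
    using derives_mp derives_S5[OF calculation(3)] derives_assumption that assms by metis
  ultimately show ?thesis using mcs_mp X unfolding mcs_def by blast
qed

text \<open>By the De Morgan clause of \<open>dual\<close>, the disjunction is in \<open>X\<close>
  iff the conjunction of the duals is not.\<close>

lemma mcs_Or:
  assumes "purely_modal A" "purely_modal B"
  shows "Or A B \<in> X \<longleftrightarrow> A \<in> X \<or> B \<in> X"
  using mcs_And[of "dual A" "dual B"] mcs_dual[of "Or A B"] mcs_dual[of A] mcs_dual[of B] assms
  by auto

lemma mcs_Dia: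
  assumes "purely_modal A"
  shows "Dia A \<in> X \<longleftrightarrow> Box (dual A) \<notin> X"
  using mcs_dual[of "Box (dual A)"] assms by simp

end

text \<open>Necessitation boxes the whole chain of implications, and axiom K then releases its
  premises one at a time.\<close>

lemma derives_Box:
  assumes "S5 (imps L A)"
  shows "derives (Box ` set L) (Box A)"
proof -
  \<comment> \<open>The assumptions stay fixed while \<open>M\<close> holds the premises still under
    the box.\<close>
  have "derives (Box ` set L) (Box A)"
    if "derives (Box ` set L) (Box (imps M A))" "set M \<subseteq> set L" for M
    using that
  proof (induction M)
    case (Cons B M)
    have pm: "purely_modal B" "purely_modal (imps M A)"
      using derives_purely_modal[OF Cons.prems(1)] by auto
    have "derives (Box ` set L) (Imp (Box B) (Box (imps M A)))"
      using derives_mp derives_S5[OF S5.ax_K[OF pm]] Cons.prems(1) by auto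
    moreover have "derives (Box ` set L) (Box B)"
      using Cons.prems(2) pm by (intro derives_assumption) auto
    ultimately show ?case using derives_mp Cons by auto
  qed simp
  then show ?thesis using derives_S5 S5.nec assms by blast
qed

section \<open>The canonical model around one maximal consistent set\<close>

lemma derives_mono: "derives X A \<Longrightarrow> X \<subseteq> Y \<Longrightarrow> derives Y A"
  unfolding derives_def by blast

text \<open>These are the points accessible from \<open>X\<close> in the canonical model.\<close>

definition successors :: "'a fm set \<Rightarrow> 'a fm set set" where
  "successors X = {Y. mcs Y \<and> (\<forall>B. Box B \<in> X \<longrightarrow> B \<in> Y)}"

text \<open>If the bodies of the boxes in \<open>X\<close> did not derive \<open>A\<close>,
  Lindenbaum's lemma would extend them to a successor without \<open>A\<close>. So they derive it,
  and boxing that derivation gives \<open>Box A\<close>.\<close>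

lemma mcs_Box_successors:
  assumes X: "mcs X" and A: "purely_modal A"
  shows "Box A \<in> X \<longleftrightarrow> (\<forall>Y\<in>successors X. A \<in> Y)"
proof
  assume all: "\<forall>Y\<in>successors X. A \<in> Y"
  have "derives {B. Box B \<in> X} A"
  proof (rule ccontr)
    assume "\<not> derives {B. Box B \<in> X} A"
    moreover have "\<And>B. Box B \<in> X \<Longrightarrow> purely_modal B"
      using X unfolding mcs_def by fastforce
    ultimately obtain Y where "{B. Box B \<in> X} \<subseteq> Y" "mcs Y" "A \<notin> Y"
      using lindenbaum[of "{B. Box B \<in> X}" A] A by blast
    then show False using all unfolding successors_def by blast
  qed
  then obtain L where L: "set L \<subseteq> {B. Box B \<in> X}" "S5 (imps L A)"
    unfolding derives_def by blast
  then have "derives X (Box A)"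
    using derives_Box by (rule_tac derives_mono) auto
  then show "Box A \<in> X" using X unfolding mcs_def by blast
qed (auto simp: successors_def)

text \<open>Axiom 4 carries a box from \<open>X\<close> to \<open>Y\<close>. Axiom 5 carries the
  diamond of the dual, so that a box absent from \<open>X\<close> is absent from
  \<open>Y\<close>.\<close>

lemma successors_Box_iff:
  assumes X: "mcs X" and Y: "Y \<in> successors X" and A: "purely_modal A"
  shows "Box A \<in> Y \<longleftrightarrow> Box A \<in> X"
proof
  have "mcs Y" using Y by (simp add: successors_def)
  show "Box A \<in> X" if "Box A \<in> Y"
  proof (rule ccontr)
    assume "Box A \<notin> X"
    then have "Dia (dual A) \<in> X" using mcs_Dia[OF X, of "dual A"] A by simp
    then have "Box (Dia (dual A)) \<in> X"
      using mcs_mp[OF X S5.ax_5] A by simp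
    then have "Dia (dual A) \<in> Y" using Y by (simp add: successors_def)
    then show False using mcs_Dia[OF \<open>mcs Y\<close>, of "dual A"] A that by simp
  qed
  show "Box A \<in> Y" if "Box A \<in> X"
    using mcs_mp[OF X S5.ax_4[OF A] that] Y by (simp add: successors_def)
qed

text \<open>A box at \<open>Y\<close> is moved to \<open>X\<close>, where it speaks about all
  successors of \<open>X\<close>. Hence quantifying over the whole of \<open>W\<close> is correct at
  every \<open>Y\<close>.\<close>

lemma canonical_sat:
  assumes X: "mcs X"
  defines "W \<equiv> (\<lambda>Y. {a. Pos a \<in> Y}) ` successors X"
  shows "purely_modal A \<Longrightarrow> Y \<in> successors X \<Longrightarrow> sat W {a. Pos a \<in> Y} A \<longleftrightarrow> A \<in> Y"
proof (induction A arbitrary: Y)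
  case (Neg a)
  then show ?case using mcs_dual[of Y "Pos a"] by (simp add: successors_def)
next
  case (Or A B)
  then show ?case using mcs_Or[of Y A B] by (simp add: successors_def)
next
  case (And A B)
  then show ?case using mcs_And[of Y A B] by (simp add: successors_def)
next
  case (Box A)
  have "Box A \<in> Y \<longleftrightarrow> (\<forall>Z\<in>successors X. A \<in> Z)"
    using successors_Box_iff[OF X] mcs_Box_successors[OF X] Box.prems by simp
  then show ?case using Box by (simp add: W_def)
next
  case (Dia A)
  \<comment> \<open>The induction hypothesis concerns \<open>A\<close> and not
    \<open>dual A\<close>, so duality is resolved at the level of membership first.\<close>
  have "Box (dual A) \<in> Y \<longleftrightarrow> (\<forall>Z\<in>successors X. dual A \<in> Z)"
    using successors_Box_iff[OF X] mcs_Box_successors[OF X] Dia.prems by simp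
  then have "Dia A \<in> Y \<longleftrightarrow> (\<exists>Z\<in>successors X. A \<in> Z)"
    using mcs_Dia[of Y A] mcs_dual[of _ A] Dia.prems by (auto simp: successors_def)
  then show ?case using Dia by (simp add: W_def)
qed simp_all

lemma valid_S5:
  assumes "purely_modal A" "valid A"
  shows "S5 A"
proof (rule ccontr)
  assume "\<not> S5 A"
  then have "\<not> derives {} A" by (simp add: derives_def)
  then obtain X where X: "mcs X" "A \<notin> X"
    using lindenbaum[of "{}" A] assms(1) by blast
  have "purely_modal B" if "Box B \<in> X" for B
    using X(1) that unfolding mcs_def by fastforce
  \<comment> \<open>By axiom T the set \<open>X\<close> is accessible from itself, so its own
    valuation is a world of the model.\<close>
  then have "X \<in> successors X"
    using mcs_mp[OF X(1) S5.ax_T] X(1) by (auto simp: successors_def)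
  then show False
    using canonical_sat[OF X(1) assms(1)] X(2) assms(2) unfolding valid_def by blast
qed

theorem theorem5p11:
  fixes A :: "'a fm"
  assumes "purely_modal A"
  shows "derivable_DKS5 A \<longleftrightarrow> S5 A"
  using assms derivable_DKS5_valid valid_derivable_DKS5 S5_valid valid_S5 by blast

end
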